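(* Let $g(z)=a_0+a_1z+\cdots+a_nz^n$ be a polynomial with real coefficients, $n\ge 1$, $a_0\neq 0$, $a_n>0$. Then all zeros of $g$ are negative (real) if and only if the infinite matrix $$\mathcal{D}_\infty(g)=\begin{pmatrix} a_0&a_1&a_2&a_3&a_4&a_5&\dots\\ 0&a_1&2a_2&3a_3&4a_4&5a_5&\dots\\ 0&a_0&a_1&a_2&a_3&a_4&\dots\\ 0&0&a_1&2a_2&3a_3&4a_4&\dots\\ 0&0&a_0&a_1&a_2&a_3&\dots\\ 0&0&0&a_1&2a_2&3a_3&\dots\\ \vdots&\vdots&\vdots&\vdots&\vdots&\vdots&\ddots \end{pmatrix}$$ is totally nonnegative.
   Context: Set $a_j=0$ for $j<0$ and for $j>n$. With rows and columns numbered from 1, the entry of $\mathcal{D}_\infty(g)$ in row $2i-1$, column $c$ is $a_{c-i}$, and the entry in row $2i$, column $c$ is $(c-i)\,a_{c-i}$ ($i,c\ge 1$). An infinite matrix is totally nonnegative if all its minors (of all finite orders) are nonnegative. *)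

theory Defs
  imports
    Complex_Main
    "HOL-Computational_Algebra.Polynomial"
    "Jordan_Normal_Form.Determinant"
begin

definition coeff_int :: "real poly \<Rightarrow> int \<Rightarrow> real" where
  "coeff_int g j = (if j < 0 then 0 else Polynomial.coeff g (nat j))"

text \<open>Infinite matrices are functions of a row and a column index, both numbered from 1;
  values at index 0 are irrelevant.  Row 2i-1 carries the coefficients of g and row 2i those of
  z g'(z), each shifted right by i-1 columns.\<close>

definition D_inf :: "real poly \<Rightarrow> nat \<Rightarrow> nat \<Rightarrow> real" where
  "D_inf g r c =
    (if odd r
     then coeff_int g (int c - int ((r + 1) div 2))
     else of_int (int c - int (r div 2)) * coeff_int g (int c - int (r div 2)))"

text \<open>The maps \<open>\<rho>\<close> and \<open>\<gamma>\<close> enumerate the selected rows and columns of a minor of order k in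
  increasing order.  The degenerate case k = 0 is harmless, since the empty determinant is 1.\<close>

definition totally_nonneg :: "(nat \<Rightarrow> nat \<Rightarrow> real) \<Rightarrow> bool" where
  "totally_nonneg M \<longleftrightarrow>
    (\<forall>k \<rho> \<gamma>. strict_mono_on {..<k} \<rho> \<and> strict_mono_on {..<k} \<gamma> \<and>
        (\<forall>i<k. 1 \<le> \<rho> i \<and> 1 \<le> \<gamma> i) \<longrightarrow>
      0 \<le> Determinant.det (Matrix.mat k k (\<lambda>(i, j). M (\<rho> i) (\<gamma> j))))"

end

theory Submission
  imports Defs "HOL-Computational_Algebra.Fundamental_Theorem_Algebra"
begin

text \<open>If all roots are negative, divide \<open>g\<close> and \<open>g'\<close> by their common factor \<open>d\<close> to get \<open>p\<close> and
  \<open>q\<close> for which \<open>q/p\<close> is a sum of fractions \<open>\<beta>/(z - x)\<close> with \<open>\<beta> > 0\<close> and \<open>x < 0\<close>. The Routh scheme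
  \<open>p = c q + z p\<^sub>1\<close> with \<open>c > 0\<close> preserves this class of pairs, and each of its steps, as well as each
  linear factor of \<open>d\<close>, multiplies the matrix by a nonnegative bidiagonal one, which preserves total
  nonnegativity.

  Conversely, the odd rows form the Toeplitz matrix of \<open>g\<close>. A totally nonnegative matrix cannot
  increase the number of sign changes of a vector, whereas a nonreal root \<open>z\<close>
  yields a vector, a perturbation of \<open>Im (w z\<^sup>j)\<close>, whose image has more sign changes.\<close>

section \<open>Total nonnegativity and variation diminution\<close>

definition minor :: "(nat \<Rightarrow> nat \<Rightarrow> real) \<Rightarrow> nat \<Rightarrow> (nat \<Rightarrow> nat) \<Rightarrow> (nat \<Rightarrow> nat) \<Rightarrow> real" where
  "minor M k \<rho> \<gamma> = det (mat k k (\<lambda>(i, j). M (\<rho> i) (\<gamma> j)))"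

text \<open>Indices start at 0 here, in contrast to \<open>totally_nonneg\<close>, so that
  \<open>mat\<close> indices and row shifts need no offset.\<close>

definition TN :: "(nat \<Rightarrow> nat \<Rightarrow> real) \<Rightarrow> bool" where
  "TN M \<longleftrightarrow> (\<forall>k \<rho> \<gamma>. strict_mono_on {..<k} \<rho> \<longrightarrow> strict_mono_on {..<k} \<gamma> \<longrightarrow> 0 \<le> minor M k \<rho> \<gamma>)"

lemma TND: "TN M \<Longrightarrow> strict_mono_on {..<k} \<rho> \<Longrightarrow> strict_mono_on {..<k} \<gamma> \<Longrightarrow> 0 \<le> minor M k \<rho> \<gamma>"
  by (simp add: TN_def)

lemma TN_entry: assumes "TN M" shows "0 \<le> M r c"
proof -
  have "0 \<le> minor M 1 (\<lambda>_. r) (\<lambda>_. c)"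
    using assms by (rule TND) (auto simp: strict_mono_on_def)
  then show ?thesis by (simp add: minor_def det_single)
qed

lemma minor_leibniz:
  "minor M k \<rho> \<gamma> =
    (\<Sum>p | p permutes {0..<k}. signof p * (\<Prod>i = 0..<k. M (\<rho> i) (\<gamma> (p i))))"
proof -
  have "(\<Prod>i = 0..<k. mat k k (\<lambda>(i, j). M (\<rho> i) (\<gamma> j)) $$ (i, p i)) = (\<Prod>i = 0..<k. M (\<rho> i) (\<gamma> (p i)))"
    if "p permutes {0..<k}" for p
  proof (rule prod.cong)
    fix i assume "i \<in> {0..<k}"
    moreover from this that have "p i \<in> {0..<k}" by (meson permutes_in_image)
    ultimately show "mat k k (\<lambda>(i, j). M (\<rho> i) (\<gamma> j)) $$ (i, p i) = M (\<rho> i) (\<gamma> (p i))" by simp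
  qed simp
  then show ?thesis
    unfolding minor_def by (subst det_def') (auto intro!: sum.cong)
qed

section \<open>Submatrices, transposition, and nonnegative row or column combinations\<close>

lemma TN_compose: 
  assumes "TN M" "strict_mono f" "strict_mono h"
  shows "TN (\<lambda>r c. M (f r) (h c))"
  unfolding TN_def
proof (intro allI impI)
  fix k \<rho> \<gamma> assume "strict_mono_on {..<k} (\<rho>::nat\<Rightarrow>nat)" "strict_mono_on {..<k} (\<gamma>::nat\<Rightarrow>nat)"
  then have "strict_mono_on {..<k} (f \<circ> \<rho>)" "strict_mono_on {..<k} (h \<circ> \<gamma>)"
    using assms by (auto simp: strict_mono_on_def strict_mono_def)
  from TND[OF assms(1) this] show "0 \<le> minor (\<lambda>r c. M (f r) (h c)) k \<rho> \<gamma>"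
    by (simp add: minor_def)
qed

lemma TN_transpose: 
  assumes "TN M" shows "TN (\<lambda>r c. M c r)"
  unfolding TN_def
proof (intro allI impI)
  fix k \<rho> \<gamma> assume *: "strict_mono_on {..<k} (\<rho>::nat\<Rightarrow>nat)" "strict_mono_on {..<k} (\<gamma>::nat\<Rightarrow>nat)"
  have "minor (\<lambda>r c. M c r) k \<rho> \<gamma> = det (transpose_mat (mat k k (\<lambda>(i, j). M (\<gamma> i) (\<rho> j))))"
    unfolding minor_def by (rule arg_cong[where f = det]) auto
  also have "\<dots> = minor M k \<gamma> \<rho>"
    unfolding minor_def by (rule det_transpose) auto
  finally show "0 \<le> minor (\<lambda>r c. M c r) k \<rho> \<gamma>" 
    using TND[OF assms *(2) *(1)] by simp
qed

text \<open>Multilinearity of the determinant in its rows: \<open>f\<close> picks one summand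
  \<open>f i\<close> out of every row \<open>\<rho> i\<close>.\<close>

lemma minor_row_sums:
  assumes "\<And>i. i < k \<Longrightarrow> finite (S (\<rho> i))"
  shows "minor (\<lambda>r c. \<Sum>s\<in>S r. w r s * M s c) k \<rho> \<gamma> =
    (\<Sum>f\<in>(\<Pi>\<^sub>E i\<in>{0..<k}. S (\<rho> i)). (\<Prod>i = 0..<k. w (\<rho> i) (f i)) * minor M k f \<gamma>)"
proof -
  let ?P = "{p. p permutes {0..<k}}" and ?F = "\<Pi>\<^sub>E i\<in>{0..<k}. S (\<rho> i)"
  have "minor (\<lambda>r c. \<Sum>s\<in>S r. w r s * M s c) k \<rho> \<gamma> =
      (\<Sum>p\<in>?P. signof p * (\<Sum>f\<in>?F. \<Prod>i = 0..<k. w (\<rho> i) (f i) * M (f i) (\<gamma> (p i))))"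
    unfolding minor_leibniz using assms by (subst prod_sum_PiE) auto
  also have "\<dots> = (\<Sum>p\<in>?P. \<Sum>f\<in>?F. (\<Prod>i = 0..<k. w (\<rho> i) (f i)) * 
      (signof p * (\<Prod>i = 0..<k. M (f i) (\<gamma> (p i)))))"
    by (simp add: prod.distrib sum_distrib_left mult_ac)
  also have "\<dots> = (\<Sum>f\<in>?F. \<Sum>p\<in>?P. (\<Prod>i = 0..<k. w (\<rho> i) (f i)) * 
      (signof p * (\<Prod>i = 0..<k. M (f i) (\<gamma> (p i)))))"
    by (rule sum.swap)
  finally show ?thesis by (simp add: minor_leibniz sum_distrib_left)
qed

lemma minor_equal_rows:
  assumes "i < k" "j < k" "i \<noteq> j" "\<rho> i = \<rho> j"
  shows "minor M k \<rho> \<gamma> = 0"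
  unfolding minor_def
  by (rule det_identical_rows[of _ k i j]) (use assms in \<open>auto intro!: eq_vecI\<close>)

text \<open>A special case of the Cauchy--Binet formula: as the index blocks are weakly ordered, every
  term of the multilinear expansion either has a repeated row or is a genuine minor.\<close>

lemma TN_row_sums:
  assumes "TN M" 
    and fin: "\<And>r. finite (S r)"
    and nonneg: "\<And>r s. s \<in> S r \<Longrightarrow> 0 \<le> w r s"
    and ord: "\<And>r r' s s'. r < r' \<Longrightarrow> s \<in> S r \<Longrightarrow> s' \<in> S r' \<Longrightarrow> s \<le> s'"
  shows "TN (\<lambda>r c. \<Sum>s\<in>S r. w r s * M s c)"
  unfolding TN_def
proof (intro allI impI)
  fix k \<rho> \<gamma> assume \<rho>: "strict_mono_on {..<k} (\<rho>::nat\<Rightarrow>nat)" and \<gamma>: "strict_mono_on {..<k} (\<gamma>::nat\<Rightarrow>nat)"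
  have "0 \<le> (\<Prod>i = 0..<k. w (\<rho> i) (f i)) * minor M k f \<gamma>" if f: "f \<in> (\<Pi>\<^sub>E i\<in>{0..<k}. S (\<rho> i))" for f
  proof (cases "strict_mono_on {..<k} f")
    case True
    then show ?thesis using f by (intro mult_nonneg_nonneg prod_nonneg nonneg TND[OF assms(1) _ \<gamma>]) auto
  next
    case False
    then obtain i j where ij: "i < k" "j < k" "i < j" "\<not> f i < f j" 
      by (auto simp: strict_mono_on_def)
    moreover have "f i \<le> f j"
      using ij f \<rho> by (intro ord[of "\<rho> i" "\<rho> j"]) (auto simp: strict_mono_on_def)
    ultimately have "f i = f j" by simp
    then have "minor M k f \<gamma> = 0"
      using ij by (intro minor_equal_rows[of i k j]) auto
    then show ?thesis by simp
  qed
  then show "0 \<le> minor (\<lambda>r c. \<Sum>s\<in>S r. w r s * M s c) k \<rho> \<gamma>"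
    by (subst minor_row_sums[OF fin]) (rule sum_nonneg)
qed

lemma TN_col_sums:
  assumes "TN M" 
    and "\<And>c. finite (S c)"
    and "\<And>c s. s \<in> S c \<Longrightarrow> 0 \<le> w c s"
    and "\<And>c c' s s'. c < c' \<Longrightarrow> s \<in> S c \<Longrightarrow> s' \<in> S c' \<Longrightarrow> s \<le> s'"
  shows "TN (\<lambda>r c. \<Sum>s\<in>S c. w c s * M r s)"
proof -
  have "TN (\<lambda>c r. \<Sum>s\<in>S c. w c s * M r s)"
    using TN_row_sums[of "\<lambda>r c. M c r" S w] TN_transpose[OF assms(1)] assms(2-4) by blast
  from TN_transpose[of "\<lambda>c r. \<Sum>s\<in>S c. w c s * M r s", OF this] show ?thesis .
qed

lemma strict_mono_permutation_eq_id:
  assumes p: "p permutes {0..<k::nat}" and "strict_mono_on {..<k} p"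
  shows "p = id"
proof -
  have "i < k \<Longrightarrow> i \<le> p i" for i
  proof (induction i)
    case (Suc i)
    then have "p i < p (Suc i)" using assms(2) by (auto simp: strict_mono_on_def)
    with Suc show ?case by simp
  qed simp
  then show ?thesis by (intro permutes_natset_ge[OF p]) auto
qed

text \<open>A permutation contributes only if \<open>\<rho> i = \<gamma> (p i)\<close> for all
  \<open>i\<close>; this makes \<open>p\<close> increasing, hence the identity, whose sign is
  1.\<close>

lemma TN_identity: "TN (\<lambda>r c. if r = c then 1 else 0)"
  unfolding TN_def
proof (intro allI impI)
  fix k \<rho> \<gamma> assume \<rho>: "strict_mono_on {..<k} (\<rho>::nat\<Rightarrow>nat)" and \<gamma>: "strict_mono_on {..<k} (\<gamma>::nat\<Rightarrow>nat)"
  have "0 \<le> signof p * (\<Prod>i = 0..<k. if \<rho> i = \<gamma> (p i) then 1 else (0::real))" 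
    if p: "p permutes {0..<k}" for p
  proof (cases "\<forall>i<k. \<rho> i = \<gamma> (p i)")
    case True
    have "strict_mono_on {..<k} p"
      unfolding strict_mono_on_def
    proof (intro allI impI)
      fix i j assume "i \<in> {..<k} \<and> j \<in> {..<k} \<and> i < j"
      then have ij: "i < k" "j < k" "i < j" by auto
      then have "\<gamma> (p i) < \<gamma> (p j)" using True \<rho> by (auto simp: strict_mono_on_def)
      moreover have "p i < k" "p j < k" using ij p permutes_in_image[OF p] by auto
      ultimately show "p i < p j" using strict_mono_on_less[OF \<gamma>] by simp
    qed
    with p have "p = id" by (rule strict_mono_permutation_eq_id)
    then show ?thesis by (auto intro!: prod_nonneg)
  next
    case False
    then have "(\<Prod>i = 0..<k. if \<rho> i = \<gamma> (p i) then 1 else (0::real)) = 0"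
      by (intro prod_zero) auto
    then show ?thesis by (simp only: mult_zero_right order_refl)
  qed
  then show "0 \<le> minor (\<lambda>r c. if r = c then 1 else 0) k \<rho> \<gamma>"
    unfolding minor_leibniz by (intro sum_nonneg) auto
qed

text \<open>Expanding the vanishing determinant of \<open>B\<close> bordered by \<open>y\<close> along the column \<open>y\<close> gives a sum
  of terms of one sign, so the leading minor of \<open>B\<close> vanishes and a column of \<open>B\<close> can be
  dropped.\<close>

lemma TN_range_not_alternating:
  assumes "TN B"
    and "\<And>i. i \<le> k \<Longrightarrow> 0 < (-1) ^ i * (\<Sum>b<k. v b * B i b)"
  shows False
  using assms
proof (induction k arbitrary: B v)
  case 0
  from "0.prems"(2)[of 0] show ?case by simp
next
  case (Suc m)
  let ?k = "Suc m"
  define y where "y i = (\<Sum>b<?k. v b * B i b)" for i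
  have y: "0 < (-1) ^ i * y i" if "i \<le> ?k" for i
    using Suc.prems(2)[OF that] by (simp add: y_def)
  \<comment> \<open>\<open>A\<close> is \<open>B\<close> with the extra first column
    \<open>y\<close>. As \<open>y\<close> combines the other columns with coefficients
    \<open>v\<close>, the vector \<open>u\<close> lies in the kernel of \<open>A\<close>.\<close>
  define A where "A = mat (Suc ?k) (Suc ?k) (\<lambda>(i, j). if j = 0 then y i else B i (j - 1))"
  have A: "A \<in> carrier_mat (Suc ?k) (Suc ?k)" by (simp add: A_def)
  define u where "u = vec (Suc ?k) (\<lambda>j. if j = 0 then 1 else - v (j - 1))"
  have "A *\<^sub>v u = 0\<^sub>v (Suc ?k)"
  proof (rule eq_vecI)
    fix i assume i: "i < dim_vec (0\<^sub>v (Suc ?k))"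
    then have "(A *\<^sub>v u) $ i = (\<Sum>j = 0..<Suc ?k. A $$ (i, j) * u $ j)"
      by (simp add: A_def u_def scalar_prod_def)
    also have "\<dots> = y i + (\<Sum>j = 0..<?k. A $$ (i, Suc j) * u $ Suc j)"
      using i by (subst sum.atLeast0_lessThan_Suc_shift) (simp add: A_def u_def)
    also have "(\<Sum>j = 0..<?k. A $$ (i, Suc j) * u $ Suc j) = (\<Sum>j = 0..<?k. - (v j * B i j))"
      using i by (intro sum.cong) (auto simp: A_def u_def)
    also have "\<dots> = - y i" by (simp add: y_def sum_negf atLeast0LessThan)
    finally show "(A *\<^sub>v u) $ i = 0\<^sub>v (Suc ?k) $ i" using i by simp
  qed (simp add: A_def)
  moreover have "u $ 0 \<noteq> 0\<^sub>v (Suc ?k) $ 0" by (simp add: u_def)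
  then have "u \<noteq> 0\<^sub>v (Suc ?k)" by metis
  moreover have "u \<in> carrier_vec (Suc ?k)" by (simp add: u_def)
  ultimately have "det A = 0"
    using det_0_iff_vec_prod_zero[OF A] by blast
  \<comment> \<open>Deleting the column \<open>y\<close> and row \<open>i\<close> leaves a minor of
    \<open>B\<close>; the cofactor sign \<open>(-1) ^ i\<close> agrees with the sign of
    \<open>y i\<close>.\<close>
  moreover have "det A = (\<Sum>i<Suc ?k. (-1) ^ i * y i * minor B ?k (\<lambda>l. if l < i then l else Suc l) (\<lambda>b. b))"
  proof (subst laplace_expansion_column[OF A, of 0])
    show "(\<Sum>i<Suc ?k. A $$ (i, 0) * cofactor A i 0) =
        (\<Sum>i<Suc ?k. (-1) ^ i * y i * minor B ?k (\<lambda>l. if l < i then l else Suc l) (\<lambda>b. b))"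
    proof (rule sum.cong)
      fix i assume "i \<in> {..<Suc ?k}"
      moreover have "mat_delete A i 0 = mat ?k ?k (\<lambda>(l, b). B (if l < i then l else Suc l) b)"
        by (rule eq_matI) (auto simp: mat_delete_def A_def)
      ultimately show "A $$ (i, 0) * cofactor A i 0 =
          (-1) ^ i * y i * minor B ?k (\<lambda>l. if l < i then l else Suc l) (\<lambda>b. b)"
        by (simp add: cofactor_def minor_def A_def)
    qed simp
  qed simp
  moreover have nn: "0 \<le> (-1) ^ i * y i * minor B ?k (\<lambda>l. if l < i then l else Suc l) (\<lambda>b. b)"
    if "i \<le> ?k" for i
    using order_less_imp_le[OF y[OF that]]
    by (rule mult_nonneg_nonneg) (rule TND[OF Suc.prems(1)]; auto simp: strict_mono_on_def)
  ultimately have "(-1) ^ ?k * y ?k * minor B ?k (\<lambda>l. if l < ?k then l else Suc l) (\<lambda>b. b) = 0"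
    using sum_nonneg_eq_0_iff[of "{..<Suc ?k}" 
      "\<lambda>i. (-1) ^ i * y i * minor B ?k (\<lambda>l. if l < i then l else Suc l) (\<lambda>b. b)"] by auto
  then have "minor B ?k (\<lambda>l. if l < ?k then l else Suc l) (\<lambda>b. b) = 0"
    using y[of ?k] by auto
  \<comment> \<open>The last term omits the last row, so its minor is the leading one.\<close>
  also have "minor B ?k (\<lambda>l. if l < ?k then l else Suc l) (\<lambda>b. b) = det (mat ?k ?k (\<lambda>(i, b). B i b))"
    unfolding minor_def by (rule arg_cong[where f = det]) auto
  finally obtain w where w: "w \<in> carrier_vec ?k" "w \<noteq> 0\<^sub>v ?k" "mat ?k ?k (\<lambda>(i, b). B i b) *\<^sub>v w = 0\<^sub>v ?k"
    using det_0_iff_vec_prod_zero[of "mat ?k ?k (\<lambda>(i, b). B i b)" ?k] by auto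
  then obtain b0 where b0: "b0 < ?k" "w $ b0 \<noteq> 0"
    by (metis carrier_vecD eq_vecI index_zero_vec)
  have Bw: "(\<Sum>b<?k. w $ b * B i b) = 0" if "i < ?k" for i
  proof -
    have "(mat ?k ?k (\<lambda>(i, b). B i b) *\<^sub>v w) $ i = 0" using w that by simp
    moreover have "(mat ?k ?k (\<lambda>(i, b). B i b) *\<^sub>v w) $ i = (\<Sum>b = 0..<?k. B i b * w $ b)"
      using w(1) that by (simp add: scalar_prod_def)
    ultimately show ?thesis by (simp add: atLeast0LessThan mult.commute)
  qed
  define h where "h b = (if b < b0 then b else Suc b)" for b
  have h: "strict_mono h" by (auto simp: h_def strict_mono_def)
  \<comment> \<open>Subtracting a multiple of the kernel vector \<open>w\<close> makes the
    coefficient at \<open>b0\<close> zero without changing the image in the first \<open>?k\<close>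
    rows. So one column and one row are lost, and alternation persists for \<open>m\<close>.\<close>
  define v' where "v' b = v b - v b0 * w $ b / w $ b0" for b
  have bij: "bij_betw h {..<m} ({..<?k} - {b0})"
  proof (rule bij_betwI[where g = "\<lambda>b. if b < b0 then b else b - 1"])
  qed (use b0 in \<open>auto simp: h_def split: if_splits\<close>)
  have "(\<Sum>b<m. v' (h b) * B i (h b)) = y i" if "i < ?k" for i
  proof -
    have "(\<Sum>b<m. v' (h b) * B i (h b)) = (\<Sum>b\<in>{..<?k} - {b0}. v' b * B i b)"
      by (rule sum.reindex_bij_betw[OF bij])
    also have "\<dots> = (\<Sum>b<?k. v' b * B i b)"
      using b0 by (subst (2) sum.remove[of _ b0]) (auto simp: v'_def)
    also have "\<dots> = y i - v b0 / w $ b0 * (\<Sum>b<?k. w $ b * B i b)"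
      unfolding v'_def y_def sum_distrib_left by (simp add: algebra_simps sum_subtractf)
    finally show ?thesis using Bw[OF that] by simp
  qed
  then have "0 < (-1) ^ i * (\<Sum>b<m. v' (h b) * B i (h b))" if "i \<le> m" for i
    using y[of i] that by simp
  then show ?case
    using Suc.IH[OF TN_compose[OF Suc.prems(1) _ h, of "\<lambda>i. i"], of "\<lambda>b. v' (h b)"] by (auto simp: strict_mono_def)
qed

section \<open>Roots of a polynomial with totally nonnegative Toeplitz matrix\<close>

lemma totally_nonneg_iff_TN: "totally_nonneg M \<longleftrightarrow> TN (\<lambda>r c. M (Suc r) (Suc c))"
proof
  assume *: "totally_nonneg M"
  show "TN (\<lambda>r c. M (Suc r) (Suc c))"
    unfolding TN_def
  proof (intro allI impI)
    fix k \<rho> \<gamma> assume "strict_mono_on {..<k} (\<rho>::nat\<Rightarrow>nat)" "strict_mono_on {..<k} (\<gamma>::nat\<Rightarrow>nat)"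
    then have "strict_mono_on {..<k} (\<lambda>i. Suc (\<rho> i))" "strict_mono_on {..<k} (\<lambda>i. Suc (\<gamma> i))"
      by (auto simp: strict_mono_on_def)
    then have "0 \<le> det (mat k k (\<lambda>(i, j). M (Suc (\<rho> i)) (Suc (\<gamma> j))))"
      using *[unfolded totally_nonneg_def, rule_format, of k "\<lambda>i. Suc (\<rho> i)" "\<lambda>i. Suc (\<gamma> i)"] by simp
    then show "0 \<le> minor (\<lambda>r c. M (Suc r) (Suc c)) k \<rho> \<gamma>"
      by (simp add: minor_def)
  qed
next
  assume *: "TN (\<lambda>r c. M (Suc r) (Suc c))"
  show "totally_nonneg M"
    unfolding totally_nonneg_def
  proof (intro allI impI)
    fix k \<rho> \<gamma> 
    assume **: "strict_mono_on {..<k} (\<rho>::nat\<Rightarrow>nat) \<and> strict_mono_on {..<k} (\<gamma>::nat\<Rightarrow>nat) \<and>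
        (\<forall>i<k. 1 \<le> \<rho> i \<and> 1 \<le> \<gamma> i)"
    have "strict_mono_on {..<k} (\<lambda>i. \<rho> i - 1)" "strict_mono_on {..<k} (\<lambda>i. \<gamma> i - 1)"
      using ** unfolding strict_mono_on_def by (intro allI impI diff_less_mono; simp)+
    from TND[OF * this] have "0 \<le> minor (\<lambda>r c. M (Suc r) (Suc c)) k (\<lambda>i. \<rho> i - 1) (\<lambda>i. \<gamma> i - 1)" .
    also have "\<dots> = det (mat k k (\<lambda>(i, j). M (\<rho> i) (\<gamma> j)))"
      unfolding minor_def using ** by (intro arg_cong[where f = det] eq_matI) (auto simp: Suc_le_eq)
    finally show "0 \<le> det (mat k k (\<lambda>(i, j). M (\<rho> i) (\<gamma> j)))" .
  qed
qed

section \<open>The Toeplitz matrix of the coefficients\<close>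

definition toeplitz :: "real poly \<Rightarrow> nat \<Rightarrow> nat \<Rightarrow> real" where
  "toeplitz g r c = (if r \<le> c then Polynomial.coeff g (c - r) else 0)"

lemma toeplitz_eq_D_inf: "toeplitz g r c = D_inf g (Suc (2 * r)) (Suc c)"
  by (auto simp: toeplitz_def D_inf_def coeff_int_def nat_diff_distrib' simp flip: of_nat_diff)

lemma TN_toeplitz_of_D_inf:
  assumes "totally_nonneg (D_inf g)"
  shows "TN (toeplitz g)"
proof -
  have "TN (\<lambda>r c. D_inf g (Suc (2 * r)) (Suc c))"
    by (rule TN_compose[OF assms[unfolded totally_nonneg_iff_TN], of "\<lambda>r. 2 * r" "\<lambda>c. c"])
       (auto simp: strict_mono_def)
  then show ?thesis by (simp add: toeplitz_eq_D_inf[abs_def])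
qed

text \<open>Row \<open>r\<close> is supported on the columns from \<open>r\<close> to
  \<open>r + degree g\<close>, so truncation at \<open>N\<close> columns loses nothing.\<close>

lemma toeplitz_row_sum:
  assumes "r + Polynomial.degree g < N"
  shows "(\<Sum>j<N. x j * toeplitz g r j) = (\<Sum>s\<le>Polynomial.degree g. Polynomial.coeff g s * x (r + s))"
proof -
  let ?n = "Polynomial.degree g"
  have "(\<Sum>s\<le>?n. Polynomial.coeff g s * x (r + s)) = (\<Sum>j\<in>(+) r ` {..?n}. x j * toeplitz g r j)"
    by (subst sum.reindex) (auto simp: toeplitz_def mult.commute)
  also have "\<dots> = (\<Sum>j<N. x j * toeplitz g r j)"
  proof (rule sum.mono_neutral_left)
    show "\<forall>j\<in>{..<N} - (+) r ` {..?n}. x j * toeplitz g r j = 0"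
    proof
      fix j assume "j \<in> {..<N} - (+) r ` {..?n}"
      then have "j < r \<or> j - r > ?n" 
        by (metis DiffD2 atMost_iff imageI le_add_diff_inverse not_le)
      then show "x j * toeplitz g r j = 0"
        by (auto simp: toeplitz_def coeff_eq_0)
    qed
  qed (use assms in auto)
  finally show ?thesis ..
qed

text \<open>Each shift by \<open>pi\<close> flips the sine, and the remainder of \<open>a\<close>
  modulo \<open>pi\<close> lies where the sine is positive.\<close>

lemma sgn_sin_floor:
  assumes "0 \<le> a" "sin a \<noteq> 0"
  shows "0 < (-1) ^ nat \<lfloor>a / pi\<rfloor> * sin a"
proof -
  define b where "b = nat \<lfloor>a / pi\<rfloor>"
  define r where "r = a - b * pi"
  have b: "real b = of_int \<lfloor>a / pi\<rfloor>" using assms by (simp add: b_def)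
  have "real b \<le> a / pi" "a / pi < real b + 1" unfolding b by linarith+
  then have r: "0 \<le> r" "r < pi" by (simp_all add: r_def field_simps)
  have "sin a = sin (r + b * pi)" by (simp add: r_def)
  also have "\<dots> = (-1) ^ b * sin r" by (simp add: sin_add)
  finally have s: "sin a = (-1) ^ b * sin r" .
  then have "r \<noteq> 0" using assms by auto
  then have "0 < sin r" using r by (intro sin_gt_zero) auto
  also have "sin r = (-1) ^ b * sin a" by (simp add: s flip: power_add mult.assoc)
  finally show ?thesis by (simp add: b_def)
qed

text \<open>Only finitely many phases in the interval make one of the finitely many sines
  vanish.\<close>

lemma ex_generic_phase:
  fixes \<theta> :: real
  assumes "0 \<le> \<theta>" "\<theta> \<le> pi"
  obtains \<phi> where "0 < \<phi>" "\<phi> < pi" "\<And>j. j < N \<Longrightarrow> sin (real j * \<theta> + \<phi>) \<noteq> 0"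
proof -
  \<comment> \<open>If \<open>j * \<theta> + \<phi> = i * pi\<close>, then \<open>i\<close> lies
    strictly between 0 and \<open>N + 1\<close>, because \<open>\<theta> \<le> pi\<close> and
    \<open>\<phi> < pi\<close>; so this finite set covers all phases to be avoided.\<close>
  let ?bad = "(\<lambda>(i, j). of_int i * pi - real j * \<theta>) ` ({0..int N + 1} \<times> {..<N})"
  have "infinite {0<..<pi}" by (simp add: infinite_Ioo)
  then have "infinite ({0<..<pi} - ?bad)" by (rule Diff_infinite_finite[rotated]) simp
  then obtain \<phi> where \<phi>: "\<phi> \<in> {0<..<pi}" "\<phi> \<notin> ?bad"
    by (metis DiffE equals0I finite.emptyI)
  have "sin (real j * \<theta> + \<phi>) \<noteq> 0" if "j < N" for j
  proof
    assume "sin (real j * \<theta> + \<phi>) = 0"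
    then obtain i :: int where i: "real j * \<theta> + \<phi> = of_int i * pi"
      by (auto simp: sin_zero_iff_int2)
    have "0 < of_int i * pi" unfolding i[symmetric] using \<phi> assms by (simp add: add_nonneg_pos)
    then have "0 < i" by (simp add: zero_less_mult_iff)
    have "real j * \<theta> \<le> real N * pi" using that assms by (intro mult_mono) auto
    then have "of_int i * pi < of_int (int N + 1) * pi"
      unfolding i[symmetric] using \<phi> by (simp add: algebra_simps)
    then have "i < int N + 1" by (simp only: mult_less_cancel_right_pos pi_gt_zero of_int_less_iff)
    with \<open>0 < i\<close> that have "of_int i * pi - real j * \<theta> \<in> ?bad" by force
    moreover have "\<phi> = of_int i * pi - real j * \<theta>" using i by simp
    ultimately show False using \<phi>(2) by metis
  qed
  with \<phi> show ?thesis by (intro that) auto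
qed

text \<open>Each inequality holds for all sufficiently small positive \<open>\<epsilon>\<close>, and
  there are finitely many. This keeps a perturbation from altering signs.\<close>

lemma ex_small_multiple:
  fixes u v :: "nat \<Rightarrow> real"
  assumes "\<And>j. j < N \<Longrightarrow> 0 < u j"
  obtains \<epsilon> where "0 < \<epsilon>" "\<And>j. j < N \<Longrightarrow> \<epsilon> * v j < u j"
proof -
  have "\<forall>\<^sub>F e in at_right 0. e * v j < u j" if "j < N" for j
  proof -
    have "((\<lambda>e. e * v j) \<longlongrightarrow> 0 * v j) (at_right 0)" by (intro tendsto_intros)
    then show ?thesis using assms[OF that] by (intro order_tendstoD(2)) auto
  qed
  then have "\<forall>\<^sub>F e in at_right 0. \<forall>j\<in>{..<N}. e * v j < u j"
    by (intro eventually_ball_finite) auto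
  moreover have "\<forall>\<^sub>F e in at_right (0::real). 0 < e" by (rule eventually_at_right_less)
  ultimately have "\<forall>\<^sub>F e in at_right 0. 0 < e \<and> (\<forall>j<N. e * v j < u j)"
    by eventually_elim auto
  then obtain \<epsilon> where "0 < \<epsilon> \<and> (\<forall>j<N. \<epsilon> * v j < u j)"
    using eventually_happens'[OF trivial_limit_at_right_real] by blast
  then show ?thesis using that by blast
qed

lemma ex_neg_nonroot:
  fixes g :: "real poly" assumes "g \<noteq> 0"
  obtains t where "0 < t" "poly g (- t) \<noteq> 0"
proof -
  have "infinite {..<0::real}" by (rule infinite_Iio)
  moreover have "finite {x. poly g x = 0}" using assms by (rule poly_roots_finite)
  ultimately have "\<not> {..<0} \<subseteq> {x. poly g x = 0}" using finite_subset by blast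
  then obtain x where "x < 0" "poly g x \<noteq> 0" by auto
  then show ?thesis using that[of "- x"] by simp
qed

lemma poly_map_poly_of_real:
  "poly (map_poly complex_of_real g) (complex_of_real x) = complex_of_real (poly g x)"
  by (simp add: poly_altdef coeff_map_poly degree_map_poly)

text \<open>If \<open>z = \<rho> e\<^sup>i\<^sup>\<theta>\<close> is a root, then \<open>x\<^sub>j = \<rho>\<^sup>j sin (j \<theta> + \<phi>)\<close> is annihilated by the Toeplitz
  matrix, and adding a tiny multiple of \<open>(-t)\<^sup>j\<close> makes the image alternate at every index.
  Among \<open>N\<close> indices \<open>x\<close> has only about \<open>N \<theta> / \<pi>\<close> sign changes, which is too few.\<close>

lemma TN_toeplitz_no_root_upper_half_plane:
  fixes g :: "real poly" and z :: complex
  assumes TN: "TN (toeplitz g)" and g: "g \<noteq> 0" 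
    and root: "poly (map_poly complex_of_real g) z = 0"
  shows "\<not> 0 < Im z"
proof
  assume "0 < Im z"
  define n where "n = Polynomial.degree g"
  define \<theta> where "\<theta> = Arg z"
  define \<rho> where "\<rho> = cmod z"
  have z: "z = rcis \<rho> \<theta>" by (simp add: \<rho>_def \<theta>_def rcis_cmod_Arg)
  have "z \<noteq> 0" using \<open>0 < Im z\<close> by auto
  then have \<rho>: "0 < \<rho>" by (simp add: \<rho>_def)
  have "0 < sin \<theta>" using \<open>0 < Im z\<close> \<rho> unfolding z by (simp add: zero_less_mult_iff)
  have "- pi < \<theta>" "\<theta> \<le> pi" using Arg_bounded[of z] by (auto simp: \<theta>_def)
  with \<open>0 < sin \<theta>\<close> have \<theta>: "0 < \<theta>" "\<theta> < pi"
  proof -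
    show "0 < \<theta>"
    proof (rule ccontr)
      assume "\<not> 0 < \<theta>"
      then have "0 \<le> sin (- \<theta>)" using \<open>- pi < \<theta>\<close> by (intro sin_ge_zero) auto
      with \<open>0 < sin \<theta>\<close> show False by simp
    qed
    show "\<theta> < pi" using \<open>\<theta> \<le> pi\<close> \<open>0 < sin \<theta>\<close> by (cases "\<theta> = pi") auto
  qed
  \<comment> \<open>As \<open>\<theta> < pi\<close>, the gap between \<open>N * pi\<close> and
    \<open>N * \<theta>\<close> is unbounded in \<open>N\<close>; this choice makes it at least
    \<open>(n + 3) * pi\<close>, which will give \<open>k + n < N\<close>.\<close>
  define N where "N = nat \<lceil>(real n + 3) * pi / (pi - \<theta>)\<rceil>"
  have "(real n + 3) * pi / (pi - \<theta>) \<le> N" unfolding N_def by linarith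
  then have N: "N * \<theta> + (real n + 3) * pi \<le> N * pi"
    using \<theta> by (simp add: field_simps)
  obtain \<phi> where \<phi>: "0 < \<phi>" "\<phi> < pi" "\<And>j. j < N \<Longrightarrow> sin (real j * \<theta> + \<phi>) \<noteq> 0"
    using ex_generic_phase[of \<theta> N] \<theta> by auto
  \<comment> \<open>The number of the half-period containing the phase at \<open>j\<close>. The sign
    of \<open>x j\<close> will be \<open>(-1) ^ b j\<close>, and \<open>b\<close> is nondecreasing,
    so equal values of \<open>b\<close> mark blocks of consecutive indices with constant
    sign.\<close>
  define b where "b j = nat \<lfloor>(real j * \<theta> + \<phi>) / pi\<rfloor>" for j
  \<comment> \<open>All \<open>b j\<close> with \<open>j < N\<close> are below \<open>k\<close>, so
    \<open>k\<close> columns hold all the blocks.\<close>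
  define k where "k = Suc (b N)"
  have b_mono: "b i \<le> b j" if "i \<le> j" for i j
    unfolding b_def using that \<theta> by (intro nat_mono floor_mono divide_right_mono add_right_mono mult_right_mono) auto
  have "real (b N) = of_int \<lfloor>(real N * \<theta> + \<phi>) / pi\<rfloor>" using \<theta> \<phi> by (simp add: b_def)
  also have "\<dots> \<le> (real N * \<theta> + \<phi>) / pi" by linarith
  finally have "real (b N) * pi \<le> real N * \<theta> + \<phi>" by (simp add: field_simps)
  then have "(real (b N) + real n + 3) * pi < (N + 1) * pi" using N \<phi> by (simp add: algebra_simps)
  then have k: "k + n < N" 
    by (simp add: k_def)
  obtain t where t: "0 < t" "poly g (- t) \<noteq> 0" using ex_neg_nonroot[OF g] by blast
  obtain \<epsilon> where \<epsilon>: "0 < \<epsilon>" "\<And>j. j < N \<Longrightarrow> \<epsilon> * t ^ j < \<rho> ^ j * \<bar>sin (real j * \<theta> + \<phi>)\<bar>"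
    using ex_small_multiple[of N "\<lambda>j. \<rho> ^ j * \<bar>sin (real j * \<theta> + \<phi>)\<bar>" "\<lambda>j. t ^ j"] \<rho> \<phi> by auto
  \<comment> \<open>With this sign the perturbation contributes \<open>(-1) ^ r\<close> times a
    positive number to row \<open>r\<close> of the image, whatever the sign of \<open>g\<close> at
    \<open>- t\<close>.\<close>
  define \<sigma> where "\<sigma> = sgn (poly g (- t))"
  define x where "x j = \<rho> ^ j * sin (real j * \<theta> + \<phi>) + \<epsilon> * \<sigma> * (- t) ^ j" for j
  have x_sgn: "(-1) ^ b j * \<bar>x j\<bar> = x j" if "j < N" for j
  proof -
    let ?s = "\<rho> ^ j * sin (real j * \<theta> + \<phi>)"
    have s: "0 < (-1) ^ b j * ?s"
    proof -
      have "0 < \<rho> ^ j * ((-1) ^ b j * sin (real j * \<theta> + \<phi>))"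
        unfolding b_def using \<phi> \<theta> \<rho> that by (intro mult_pos_pos sgn_sin_floor) auto
      then show ?thesis by (simp only: mult.left_commute)
    qed
    have "\<bar>\<epsilon> * \<sigma> * (- t) ^ j\<bar> = \<epsilon> * t ^ j" 
      using \<epsilon> t by (auto simp: abs_mult \<sigma>_def power_abs sgn_if)
    also have "\<dots> < \<bar>?s\<bar>" using \<epsilon>(2)[OF that] \<rho> by (simp add: abs_mult)
    finally have "\<bar>\<epsilon> * \<sigma> * (- t) ^ j\<bar> < \<bar>?s\<bar>" .
    with s show ?thesis unfolding x_def
      by (cases "even (b j)") (auto simp: abs_if split: if_splits)
  qed
  \<comment> \<open>Column \<open>c\<close> merges the block \<open>b j = c\<close> with the
    positive weights \<open>\<bar>x j\<bar>\<close>; the signs are left to the vector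
    \<open>(-1) ^ c\<close>. An empty block gives a zero column.\<close>
  define B where "B r c = (\<Sum>j\<in>{j. j < N \<and> b j = c}. \<bar>x j\<bar> * toeplitz g r j)" for r c
  have "TN B" 
    unfolding B_def
  proof (rule TN_col_sums[OF TN])
    fix c c' j j' :: nat assume "c < c'" "j \<in> {j. j < N \<and> b j = c}" "j' \<in> {j. j < N \<and> b j = c'}"
    then show "j \<le> j'" using b_mono[of j' j] by (cases "j \<le> j'") auto
  qed auto
  moreover have "0 < (-1) ^ r * (\<Sum>c<k. (-1) ^ c * B r c)" if "r \<le> k" for r
  proof -
    have "(\<Sum>c<k. (-1) ^ c * B r c) = (\<Sum>c<k. \<Sum>j | j \<in> {..<N} \<and> b j = c. x j * toeplitz g r j)"
      unfolding B_def sum_distrib_left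
    proof (intro sum.cong refl)
      fix c j assume "j \<in> {j. j \<in> {..<N} \<and> b j = c}"
      then show "(-1) ^ c * (\<bar>x j\<bar> * toeplitz g r j) = x j * toeplitz g r j"
        using x_sgn[of j] by (simp flip: mult.assoc)
    qed auto
    also have "\<dots> = (\<Sum>j<N. x j * toeplitz g r j)"
      using b_mono by (intro sum.group) (auto simp: k_def less_Suc_eq_le)
    also have "\<dots> = (\<Sum>s\<le>n. Polynomial.coeff g s * x (r + s))"
      using k that unfolding n_def by (intro toeplitz_row_sum) simp
    also have "\<dots> = (\<Sum>s\<le>n. Polynomial.coeff g s * (\<rho> ^ (r + s) * sin (real (r + s) * \<theta> + \<phi>)))
        + \<epsilon> * \<sigma> * (- t) ^ r * (\<Sum>s\<le>n. Polynomial.coeff g s * (- t) ^ s)"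
      unfolding x_def sum_distrib_left sum.distrib[symmetric] 
      by (intro sum.cong refl) (simp add: algebra_simps power_add)
    also have "(\<Sum>s\<le>n. Polynomial.coeff g s * (- t) ^ s) = poly g (- t)"
      by (simp add: poly_altdef n_def)
    \<comment> \<open>The unperturbed part is the imaginary part of a multiple of the value of
      \<open>g\<close> at its root \<open>z\<close>, hence zero.\<close>
    also have "(\<Sum>s\<le>n. Polynomial.coeff g s * (\<rho> ^ (r + s) * sin (real (r + s) * \<theta> + \<phi>))) 
        = Im (cis \<phi> * z ^ r * poly (map_poly complex_of_real g) z)"
    proof -
      have "cis \<phi> * z ^ r * poly (map_poly complex_of_real g) z = 
          (\<Sum>s\<le>n. cis \<phi> * z ^ r * (complex_of_real (Polynomial.coeff g s) * z ^ s))"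
        by (simp add: poly_altdef n_def coeff_map_poly degree_map_poly sum_distrib_left)
      also have "\<dots> = (\<Sum>s\<le>n. complex_of_real (Polynomial.coeff g s) * rcis (\<rho> ^ (r + s)) (real (r + s) * \<theta> + \<phi>))"
      proof (intro sum.cong refl)
        fix s
        have "rcis (\<rho> ^ (r + s)) (real (r + s) * \<theta> + \<phi>) = z ^ (r + s) * cis \<phi>"
          unfolding z DeMoivre2 by (simp add: rcis_def cis_mult)
        then show "cis \<phi> * z ^ r * (complex_of_real (Polynomial.coeff g s) * z ^ s) =
            complex_of_real (Polynomial.coeff g s) * rcis (\<rho> ^ (r + s)) (real (r + s) * \<theta> + \<phi>)"
          by (simp add: power_add mult_ac)
      qed
      finally show ?thesis by simp
    qed
    finally have "(\<Sum>c<k. (-1) ^ c * B r c) = (-1) ^ r * (\<epsilon> * t ^ r * (\<sigma> * poly g (- t)))"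
      using root by (simp add: power_minus[of t])
    also have "\<sigma> * poly g (- t) = \<bar>poly g (- t)\<bar>" by (simp add: \<sigma>_def sgn_mult_self_eq abs_sgn mult.commute)
    finally have "(-1) ^ r * (\<Sum>c<k. (-1) ^ c * B r c) = \<epsilon> * t ^ r * \<bar>poly g (- t)\<bar>"
      by (simp add: power_mult_distrib[symmetric] flip: mult.assoc)
    then show ?thesis using \<epsilon>(1) t by simp
  qed
  ultimately show False by (rule TN_range_not_alternating)
qed

text \<open>Conjugation excludes the lower half plane as well. On the nonnegative axis
  \<open>g\<close> is positive, since its coefficients are entries of a totally nonnegative matrix
  and the constant one is nonzero.\<close>

lemma TN_toeplitz_imp_negative_roots:
  fixes g :: "real poly" and z :: complex
  assumes TN: "TN (toeplitz g)" and g0: "Polynomial.coeff g 0 \<noteq> 0"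
    and root: "poly (map_poly complex_of_real g) z = 0"
  shows "z \<in> \<real> \<and> Re z < 0"
proof -
  have g: "g \<noteq> 0" using g0 by auto
  have "\<not> 0 < Im z" using TN_toeplitz_no_root_upper_half_plane[OF TN g root] .
  moreover have "poly (map_poly complex_of_real g) (cnj z) = cnj (poly (map_poly complex_of_real g) z)"
    by (subst poly_cnj) (simp add: map_poly_map_poly o_def)
  then have "\<not> 0 < Im (cnj z)" 
    by (intro TN_toeplitz_no_root_upper_half_plane[OF TN g]) (simp add: root)
  ultimately have "Im z = 0" by simp
  then have z: "z = of_real (Re z)" by (simp add: complex_eq_iff)
  have "poly g (Re z) = 0" using root by (subst (asm) z) (simp add: poly_map_poly_of_real)
  moreover have "0 < poly g x" if "0 \<le> x" for x
  proof -
    have nonneg: "0 \<le> Polynomial.coeff g i" for i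
      using TN_entry[OF TN, of 0 i] by (simp add: toeplitz_def)
    have "0 < Polynomial.coeff g 0" using nonneg[of 0] g0 by simp
    also have "\<dots> = Polynomial.coeff g 0 * x ^ 0" by simp
    also have "\<dots> \<le> (\<Sum>i\<le>Polynomial.degree g. Polynomial.coeff g i * x ^ i)"
      by (rule member_le_sum) (use nonneg that in auto)
    finally show ?thesis by (simp add: poly_altdef)
  qed
  ultimately have "Re z < 0" by (metis less_irrefl not_le)
  then show ?thesis using z by (metis Reals_of_real)
qed

section \<open>Matrices of Hurwitz type\<close>

text \<open>Row \<open>2 i\<close> lists the coefficients of \<open>z^i p\<close> and row
  \<open>2 i + 1\<close> those of \<open>z^(i+1) q\<close>. Stated through polynomial multiples,
  identities between polynomials become identities between rows.\<close>

definition hurwitz :: "real poly \<Rightarrow> real poly \<Rightarrow> nat \<Rightarrow> nat \<Rightarrow> real" where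
  "hurwitz p q r c = Polynomial.coeff (Polynomial.monom 1 (Suc r div 2) * (if even r then p else q)) c"

lemma D_inf_eq_hurwitz: "D_inf g (Suc r) (Suc c) = hurwitz g (pderiv g) r c"
proof (cases "even r")
  case True
  then obtain i where "r = 2 * i" by (elim evenE)
  then show ?thesis
    by (auto simp: D_inf_def hurwitz_def coeff_int_def coeff_monom_mult nat_diff_distrib' simp flip: of_nat_diff)
next
  case False
  then obtain i where r: "r = 2 * i + 1" by (elim oddE)
  have "real_of_int (int c - int i) * coeff_int g (int c - int i) = 
      (if Suc i \<le> c then Polynomial.coeff (pderiv g) (c - Suc i) else 0)"
  proof (cases "Suc i \<le> c")
    case True
    then obtain m where "c = Suc i + m" using le_Suc_ex by blast
    then show ?thesis by (simp add: coeff_int_def coeff_pderiv nat_add_distrib)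
  next
    case False
    \<comment> \<open>For \<open>c = i\<close> the factor \<open>c - i\<close> removes the constant
      coefficient; for \<open>c < i\<close> the coefficient has a negative index.\<close>
    then show ?thesis by (cases "c = i") (auto simp: coeff_int_def)
  qed
  then show ?thesis using r by (simp add: D_inf_def hurwitz_def coeff_monom_mult)
qed

text \<open>Since \<open>z^i p = c z^i q + z^(i+1) p1\<close>, an even row \<open>r\<close> is
  \<open>c\<close> times row \<open>r\<close> plus row \<open>r + 1\<close> of the matrix of
  \<open>q\<close> and \<open>p1\<close>; an odd row \<open>r\<close> is row \<open>r + 1\<close> of
  it. These index sets are weakly ordered.\<close>

lemma TN_hurwitz_step:
  assumes "TN (hurwitz q p1)" "0 \<le> c" "p = smult c q + pCons 0 p1"
  shows "TN (hurwitz p q)"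
proof -
  let ?S = "\<lambda>r. if even r then {r, Suc r} else {Suc r}" 
  let ?w = "\<lambda>r s. if even r \<and> s = r then c else 1"
  have "hurwitz p q = (\<lambda>r j. \<Sum>s\<in>?S r. ?w r s * hurwitz q p1 s j)"
    by (intro ext) (auto simp: hurwitz_def assms(3) coeff_monom_mult coeff_pCons' elim!: evenE)
  moreover have "TN (\<lambda>r j. \<Sum>s\<in>?S r. ?w r s * hurwitz q p1 s j)"
    by (rule TN_row_sums[OF assms(1)]) (use \<open>0 \<le> c\<close> in \<open>auto split: if_splits elim!: evenE oddE\<close>)
  ultimately show ?thesis by (simp only:)
qed

text \<open>The end of the Routh scheme: a multiple of the identity matrix with zero rows
  interspersed, which come from empty index sets.\<close>

lemma TN_hurwitz_const:
  assumes "0 \<le> C" shows "TN (hurwitz [:C:] 0)"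
proof -
  let ?S = "\<lambda>r. if even r then {r div 2} else {}" 
  have "hurwitz [:C:] 0 = (\<lambda>r j. \<Sum>s\<in>?S r. C * (if s = j then 1 else 0))"
    by (intro ext) (auto simp: hurwitz_def coeff_monom_mult coeff_pCons' elim!: evenE)
  moreover have "TN (\<lambda>r j. \<Sum>s\<in>?S r. C * (if s = j then 1 else 0))"
    by (rule TN_row_sums[OF TN_identity]) (use assms in \<open>auto split: if_splits elim!: evenE\<close>)
  ultimately show ?thesis by (simp only:)
qed

text \<open>Multiplication by \<open>z - x\<close> adds \<open>- x\<close> times each column to the
  preceding one, a bidiagonal factor on the right that is nonnegative for
  \<open>x \<le> 0\<close>.\<close>

lemma TN_hurwitz_mult_linear:
  assumes "TN (hurwitz p q)" "x \<le> 0"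
  shows "TN (hurwitz ([:- x, 1:] * p) ([:- x, 1:] * q))"
proof -
  let ?S = "\<lambda>c. if c = 0 then {0} else {c - 1, c}" 
  let ?w = "\<lambda>c s. if s = c then - x else 1"
  have "hurwitz ([:- x, 1:] * p) ([:- x, 1:] * q) = (\<lambda>r c. \<Sum>s\<in>?S c. ?w c s * hurwitz p q r s)"
  proof (intro ext)
    fix r c
    have "hurwitz ([:- x, 1:] * p) ([:- x, 1:] * q) r c = 
        Polynomial.coeff ([:- x, 1:] * (Polynomial.monom 1 (Suc r div 2) * (if even r then p else q))) c"
      unfolding hurwitz_def by (simp only: mult.left_commute if_distrib[where f = "\<lambda>p. _ * p"])
    then show "hurwitz ([:- x, 1:] * p) ([:- x, 1:] * q) r c = (\<Sum>s\<in>?S c. ?w c s * hurwitz p q r s)"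
      by (cases c) (simp_all add: hurwitz_def coeff_pCons)
  qed
  moreover have "TN (\<lambda>r c. \<Sum>s\<in>?S c. ?w c s * hurwitz p q r s)"
    by (rule TN_col_sums[OF assms(1)]) (use assms(2) in \<open>auto split: if_splits\<close>)
  ultimately show ?thesis by (simp only:)
qed

lemma TN_hurwitz_smult:
  assumes "TN (hurwitz p q)" "0 \<le> C"
  shows "TN (hurwitz (smult C p) (smult C q))"
proof -
  have "hurwitz (smult C p) (smult C q) = (\<lambda>r c. \<Sum>s\<in>{r}. C * hurwitz p q s c)"
    by (intro ext) (simp add: hurwitz_def)
  moreover have "TN (\<lambda>r c. \<Sum>s\<in>{r}. C * hurwitz p q s c)"
    by (rule TN_row_sums[OF assms(1)]) (use assms(2) in auto)
  ultimately show ?thesis by (simp only:)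
qed

lemma TN_hurwitz_mult_prod:
  assumes "TN (hurwitz p q)" "\<And>x. x \<in> X \<Longrightarrow> x \<le> 0"
  shows "TN (hurwitz ((\<Prod>x\<in>X. [:- x, 1:] ^ e x) * p) ((\<Prod>x\<in>X. [:- x, 1:] ^ e x) * q))"
  using assms(2)
proof (induction X rule: infinite_finite_induct)
  case (insert x X)
  let ?d = "\<Prod>x\<in>X. [:- x, 1:] ^ e x"
  have IH: "TN (hurwitz (?d * p) (?d * q))" and x: "x \<le> 0"
    using insert.IH insert.prems by blast+
  have "TN (hurwitz ([:- x, 1:] ^ m * (?d * p)) ([:- x, 1:] ^ m * (?d * q)))" for m
  proof (induction m)
    case 0
    from IH show ?case by (simp only: power_0 mult_1_left)
  next
    case (Suc m)
    from TN_hurwitz_mult_linear[OF Suc x] show ?case by (simp only: power_Suc mult.assoc)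
  qed
  from this[of "e x"] show ?case by (simp only: prod.insert[OF insert.hyps] mult.assoc)
qed (use assms(1) in simp_all)

section \<open>Real-rooted polynomials\<close>

lemma map_poly_of_real_mult:
  "map_poly complex_of_real (p * q) = map_poly of_real p * map_poly of_real q"
  by (intro poly_eqI) (simp add: coeff_map_poly coeff_mult)

lemma map_poly_of_real_add:
  "map_poly complex_of_real (p + q) = map_poly of_real p + map_poly of_real q"
  by (intro poly_eqI) (simp add: coeff_map_poly)

lemma map_poly_of_real_smult:
  "map_poly complex_of_real (smult c p) = smult (of_real c) (map_poly of_real p)"
  by (intro poly_eqI) (simp add: coeff_map_poly)

lemma map_poly_of_real_sum:
  "map_poly complex_of_real (\<Sum>i\<in>A. f i) = (\<Sum>i\<in>A. map_poly of_real (f i))"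
  by (intro poly_eqI) (simp add: coeff_map_poly coeff_sum)

lemma map_poly_of_real_power:
  "map_poly complex_of_real (p ^ m) = map_poly of_real p ^ m"
  by (induction m) (simp_all add: map_poly_of_real_mult)

lemma map_poly_of_real_prod:
  "map_poly complex_of_real (\<Prod>i\<in>A. f i) = (\<Prod>i\<in>A. map_poly of_real (f i))"
  by (induction A rule: infinite_finite_induct) (simp_all add: map_poly_of_real_mult)

lemmas map_poly_of_real_hom = map_poly_of_real_mult map_poly_of_real_add map_poly_of_real_smult
  map_poly_of_real_sum map_poly_of_real_power map_poly_of_real_prod

lemma map_poly_of_real_linear: "map_poly complex_of_real [:a, b:] = [:of_real a, of_real b:]"
  by (simp add: map_poly_pCons)

text \<open>Over the complex numbers \<open>g\<close> splits. As all roots are real, the product is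
  the image of a real one, and the embedding is injective on coefficients.\<close>

lemma real_rooted_factorization:
  fixes g :: "real poly"
  assumes "g \<noteq> 0" and real: "\<And>z. poly (map_poly complex_of_real g) z = 0 \<Longrightarrow> z \<in> \<real>"
  obtains e where "g = smult (lead_coeff g) (\<Prod>x | poly g x = 0. [:- x, 1:] ^ e x)"
    and "\<And>x. poly g x = 0 \<Longrightarrow> 0 < e x"
proof
  let ?h = "map_poly complex_of_real g"
  define e where "e x = Polynomial.order (complex_of_real x) ?h" for x
  have "?h \<noteq> 0" using \<open>g \<noteq> 0\<close> by (simp add: map_poly_eq_0_iff)
  then show "0 < e x" if "poly g x = 0" for x
    using that by (simp add: e_def order_gt_0_iff poly_map_poly_of_real)
  have roots: "{z. poly ?h z = 0} = complex_of_real ` {x. poly g x = 0}"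
  proof (intro equalityI subsetI)
    fix z assume "z \<in> {z. poly ?h z = 0}"
    moreover from this obtain x where "z = of_real x" using real by (auto elim: Reals_cases)
    ultimately show "z \<in> complex_of_real ` {x. poly g x = 0}" by (simp add: poly_map_poly_of_real)
  qed (auto simp: poly_map_poly_of_real)
  have "?h = smult (lead_coeff ?h) (\<Prod>z\<in>complex_of_real ` {x. poly g x = 0}. [:-z, 1:] ^ Polynomial.order z ?h)"
    using complex_poly_decompose[of ?h] by (simp add: roots)
  also have "\<dots> = smult (lead_coeff ?h) (\<Prod>x | poly g x = 0. [:- of_real x, 1:] ^ e x)"
    by (subst prod.reindex) (auto simp: inj_on_def e_def)
  also have "\<dots> = map_poly of_real (smult (lead_coeff g) (\<Prod>x | poly g x = 0. [:- x, 1:] ^ e x))"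
    by (simp add: map_poly_of_real_hom map_poly_of_real_linear degree_map_poly coeff_map_poly)
  finally have eq: "?h = map_poly of_real (smult (lead_coeff g) (\<Prod>x | poly g x = 0. [:- x, 1:] ^ e x))" .
  show "g = smult (lead_coeff g) (\<Prod>x | poly g x = 0. [:- x, 1:] ^ e x)"
  proof (rule poly_eqI)
    fix i
    from arg_cong[OF eq, of "\<lambda>p. Polynomial.coeff p i"]
    show "Polynomial.coeff g i = 
        Polynomial.coeff (smult (lead_coeff g) (\<Prod>x | poly g x = 0. [:- x, 1:] ^ e x)) i"
      by (simp only: coeff_map_poly of_real_0 of_real_eq_iff)
  qed
qed

text \<open>An exponent of at least 2 would make the derivative vanish at the root.\<close>

lemma real_rooted_simple_factorization:
  fixes g :: "real poly"
  assumes "g \<noteq> 0" and real: "\<And>z. poly (map_poly complex_of_real g) z = 0 \<Longrightarrow> z \<in> \<real>"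
    and simple: "\<And>x. poly g x = 0 \<Longrightarrow> poly (pderiv g) x \<noteq> 0"
  shows "g = smult (lead_coeff g) (\<Prod>x | poly g x = 0. [:- x, 1:])"
proof -
  obtain e where e: "g = smult (lead_coeff g) (\<Prod>x | poly g x = 0. [:- x, 1:] ^ e x)"
    "\<And>x. poly g x = 0 \<Longrightarrow> 0 < e x"
    using real_rooted_factorization[OF assms(1,2)] by metis
  have fin: "finite {x. poly g x = 0}" using \<open>g \<noteq> 0\<close> by (rule poly_roots_finite)
  have "e x = 1" if x: "poly g x = 0" for x
  proof (rule ccontr)
    assume "e x \<noteq> 1"
    with e(2)[OF x] have "2 \<le> e x" by simp
    then have "[:- x, 1:]\<^sup>2 dvd [:- x, 1:] ^ e x" by (rule le_imp_power_dvd)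
    also have "\<dots> dvd (\<Prod>x | poly g x = 0. [:- x, 1:] ^ e x)" 
      using fin x by (intro dvd_prodI) auto
    also have "\<dots> dvd g" by (subst e(1)) (simp add: dvd_smult)
    finally obtain h where "g = [:- x, 1:]\<^sup>2 * h" by (elim dvdE)
    then have "poly (pderiv g) x = 0" by (simp only: pderiv_mult power2_eq_square mult.assoc poly_add poly_mult) simp
    with simple[OF x] show False by simp
  qed
  then have "(\<Prod>x | poly g x = 0. [:- x, 1:] ^ e x) = (\<Prod>x | poly g x = 0. [:- x, 1:])"
    by (intro prod.cong) auto
  with e(1) show ?thesis by simp
qed

lemma degree_prod_linear: "Polynomial.degree (\<Prod>x\<in>X. [:- x, 1::real:]) = card X"
  by (cases "finite X") (simp_all add: degree_prod_eq_sum_degree)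

lemma lead_coeff_prod_linear: "Polynomial.coeff (\<Prod>x\<in>X. [:- x, 1::real:]) (card X) = 1"
  using lead_coeff_prod[of "\<lambda>x. [:- x, 1::real:]" X] by (simp add: degree_prod_linear)

section \<open>Stieltjes functions and the Routh scheme\<close>

text \<open>Data of a rational function \<open>q / p\<close>: \<open>X\<close> holds its poles,
  \<open>\<beta>\<close> its residues, \<open>\<delta>\<close> is its value at infinity, and
  \<open>C\<close> is the leading coefficient of \<open>p\<close>.\<close>

locale stieltjes_pair =
  fixes X :: "real set" and C \<delta> :: real and \<beta> :: "real \<Rightarrow> real"
  assumes fin: "finite X" and neg: "\<And>x. x \<in> X \<Longrightarrow> x < 0" and C: "0 < C" 
    and \<delta>: "0 \<le> \<delta>" and \<beta>: "\<And>x. x \<in> X \<Longrightarrow> 0 < \<beta> x"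
begin

definition p :: "real poly" where "p = smult C (\<Prod>y\<in>X. [:- y, 1:])"

text \<open>For \<open>x\<close> in \<open>X\<close> this is \<open>p / (z - x)\<close>, so dividing
  \<open>q\<close> by \<open>p\<close> produces the partial fractions.\<close>

definition P :: "real \<Rightarrow> real poly" where "P x = smult C (\<Prod>y\<in>X - {x}. [:- y, 1:])"

definition q :: "real poly" where "q = smult \<delta> p + (\<Sum>x\<in>X. smult (\<beta> x) (P x))"

lemma p_split: "x \<in> X \<Longrightarrow> p = [:- x, 1:] * P x"
  unfolding p_def P_def using fin by (subst prod.remove[of X x]) (simp_all only: mult_smult_right)

lemma degree_p: "Polynomial.degree p = card X"
  using C by (simp add: p_def degree_prod_linear)

lemma coeff_p_card: "Polynomial.coeff p (card X) = C"
  by (simp add: p_def lead_coeff_prod_linear)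

lemma degree_P: "Polynomial.degree (P x) = card (X - {x})"
  using C by (simp add: P_def degree_prod_linear)

lemma degree_P_less: "x \<in> X \<Longrightarrow> Polynomial.degree (P x) < card X"
  unfolding degree_P by (rule card_Diff1_less[OF fin])

lemma coeff_P: "x \<in> X \<Longrightarrow> Polynomial.coeff (P x) (card X - 1) = C"
  using lead_coeff_prod_linear[of "X - {x}"] fin by (simp add: P_def card_Diff_singleton)

section \<open>Values and zeros\<close>

lemma poly_P_pos: "0 \<le> t \<Longrightarrow> 0 < poly (P x) t"
  unfolding P_def using C neg by (auto simp: poly_prod intro!: mult_pos_pos prod_pos add_nonneg_pos dest!: neg)

lemma poly_p_pos: "0 \<le> t \<Longrightarrow> 0 < poly p t"
  unfolding p_def using C neg by (auto simp: poly_prod intro!: mult_pos_pos prod_pos add_nonneg_pos dest!: neg)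

lemma poly_p_eq_0_iff: "poly p t = 0 \<longleftrightarrow> t \<in> X"
  using C fin by (auto simp: p_def poly_prod prod_zero_iff)

lemma poly_P_eq_0_iff: "poly (P x) t = 0 \<longleftrightarrow> t \<in> X - {x}"
  using C fin by (auto simp: P_def poly_prod prod_zero_iff)

lemma poly_q: "poly q t = \<delta> * poly p t + (\<Sum>x\<in>X. \<beta> x * poly (P x) t)"
  by (simp add: q_def poly_sum)

text \<open>At a pole only its own summand survives. Together with \<open>poly_pderiv_p_X\<close>
  this gives the residue formula \<open>\<beta> x = q(x) / p'(x)\<close>.\<close>

lemma poly_q_X: assumes "x \<in> X" shows "poly q x = \<beta> x * poly (P x) x"
proof -
  have "poly p x = 0" using assms by (simp add: poly_p_eq_0_iff)
  moreover have "(\<Sum>y\<in>X - {x}. \<beta> y * poly (P y) x) = 0"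
    using assms by (intro sum.neutral) (auto simp: poly_P_eq_0_iff)
  ultimately show ?thesis 
    unfolding poly_q using sum.remove[OF fin assms, of "\<lambda>y. \<beta> y * poly (P y) x"] by simp
qed

lemma poly_pderiv_p_X: "x \<in> X \<Longrightarrow> poly (pderiv p) x = poly (P x) x"
  by (subst p_split) (simp_all only: pderiv_mult poly_add poly_mult, simp add: pderiv_pCons)

text \<open>The derivative of \<open>q / p\<close> is minus the sum of
  \<open>\<beta> x / (z - x)^2\<close>; multiply by \<open>p^2\<close>.\<close>

lemma wronskian: "pderiv q * p - q * pderiv p = - (\<Sum>x\<in>X. smult (\<beta> x) (P x * P x))"
proof -
  have "pderiv (P x) * p - P x * pderiv p = - (P x * P x)" if "x \<in> X" for x
  proof -
    have "pderiv p = P x + [:- x, 1:] * pderiv (P x)"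
      by (subst p_split[OF that]) (simp add: pderiv_mult pderiv_pCons del: mult_pCons_left)
    moreover have "p = [:- x, 1:] * P x" by (rule p_split[OF that])
    ultimately show ?thesis by (simp add: algebra_simps del: mult_pCons_left mult_pCons_right)
  qed
  then have "(\<Sum>x\<in>X. smult (\<beta> x) (pderiv (P x) * p - P x * pderiv p)) = - (\<Sum>x\<in>X. smult (\<beta> x) (P x * P x))"
    by (simp add: sum_negf)
  moreover have "pderiv (\<Sum>x\<in>X. smult (\<beta> x) (P x)) = (\<Sum>x\<in>X. smult (\<beta> x) (pderiv (P x)))"
    by (simp add: higher_pderiv_sum[of 1, simplified] pderiv_smult)
  then have "pderiv q = smult \<delta> (pderiv p) + (\<Sum>x\<in>X. smult (\<beta> x) (pderiv (P x)))"
    by (simp add: q_def pderiv_add pderiv_smult)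
  ultimately show ?thesis
    by (simp add: q_def algebra_simps sum_distrib_left sum_distrib_right smult_diff_right sum_subtractf)
qed

text \<open>A Stieltjes function with a pole maps the open upper half plane to the lower one and
  vice versa, so it has no nonreal zero. Multiplying by the squared modulus of \<open>p\<close>
  avoids division.\<close>

lemma q_complex_roots_real:
  assumes "q \<noteq> 0" "poly (map_poly complex_of_real q) z = 0"
  shows "z \<in> \<real>"
proof (rule ccontr)
  assume z: "z \<notin> \<real>"
  define ev where "ev f = poly (map_poly complex_of_real f) z" for f
  have zx: "z \<noteq> of_real x" for x using z by auto
  have P: "ev (P x) \<noteq> 0" for x
    using C fin zx by (auto simp: ev_def P_def map_poly_of_real_hom map_poly_of_real_linear poly_prod prod_zero_iff)
  have p: "ev p * cnj (ev p) = of_real ((cmod (ev p))\<^sup>2)" 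
    by (rule complex_norm_square[symmetric])
  have "0 = Im (ev q * cnj (ev p))" using assms(2) by (simp add: ev_def)
  also have "ev q = of_real \<delta> * ev p + (\<Sum>x\<in>X. of_real (\<beta> x) * ev (P x))"
    by (simp add: q_def ev_def map_poly_of_real_hom poly_sum)
  also have "\<dots> * cnj (ev p) = of_real (\<delta> * (cmod (ev p))\<^sup>2) + (\<Sum>x\<in>X. of_real (\<beta> x) * (ev (P x) * cnj (ev p)))"
    by (simp add: distrib_right sum_distrib_right mult.assoc p)
  also have "\<dots> = of_real (\<delta> * (cmod (ev p))\<^sup>2) + (\<Sum>x\<in>X. of_real (\<beta> x * (cmod (ev (P x)))\<^sup>2) * cnj (z - of_real x))"
  proof (intro arg_cong2[where f = "(+)"] sum.cong refl)
    fix x assume "x \<in> X"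
    then have "ev p = (z - of_real x) * ev (P x)"
      unfolding ev_def by (subst p_split) (simp_all only: map_poly_of_real_hom poly_mult, simp add: map_poly_of_real_linear)
    then show "of_real (\<beta> x) * (ev (P x) * cnj (ev p)) = of_real (\<beta> x * (cmod (ev (P x)))\<^sup>2) * cnj (z - of_real x)"
      by (simp only: of_real_mult complex_norm_square complex_cnj_mult mult_ac)
  qed
  also have "Im \<dots> = - Im z * (\<Sum>x\<in>X. \<beta> x * (cmod (ev (P x)))\<^sup>2)"
    by (simp add: Im_sum sum_distrib_left sum_negf mult_ac flip: of_real_power of_real_mult)
  finally have "(\<Sum>x\<in>X. \<beta> x * (cmod (ev (P x)))\<^sup>2) = 0" 
    using z by (auto simp: complex_is_Real_iff)
  moreover have "0 < (\<Sum>x\<in>X. \<beta> x * (cmod (ev (P x)))\<^sup>2)" if "X \<noteq> {}"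
    using fin that \<beta> P by (intro sum_pos) auto
  \<comment> \<open>Without poles \<open>q\<close> is constant, and a nonzero constant has no
    root.\<close>
  ultimately have "X = {}" by fastforce
  with assms show False unfolding q_def p_def by (simp add: map_poly_pCons)
qed

lemma poly_q_pos:
  assumes "q \<noteq> 0" "0 \<le> t" shows "0 < poly q t"
proof (cases "X = {}")
  case True
  have "\<delta> \<noteq> 0" using assms(1) unfolding q_def by (auto simp: True)
  moreover have "poly q t = \<delta> * C" unfolding poly_q p_def by (simp add: True)
  ultimately show ?thesis using \<delta> C by simp
next
  case False
  then have "0 < (\<Sum>x\<in>X. \<beta> x * poly (P x) t)"
    using fin \<beta> poly_P_pos[OF assms(2)] by (intro sum_pos) auto
  then show ?thesis
    unfolding poly_q using \<delta> poly_p_pos[OF assms(2)] by (intro add_nonneg_pos) auto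
qed

text \<open>At a zero of \<open>q\<close> the Wronskian reduces to \<open>q' p\<close>, and it is
  negative there because the zero is not a pole. In particular the zeros of \<open>q\<close> are
  simple.\<close>

lemma q_root_sign:
  assumes "q \<noteq> 0" "poly q y = 0" shows "y < 0" "poly p y * poly (pderiv q) y < 0"
proof -
  show "y < 0" using poly_q_pos[OF assms(1), of y] assms(2) by force
  have "y \<notin> X"
  proof
    assume "y \<in> X"
    then have "poly q y \<noteq> 0" using \<beta>[of y] by (simp add: poly_q_X poly_P_eq_0_iff)
    with assms show False by simp
  qed
  have "X \<noteq> {}"
    using assms by (auto simp: q_def p_def)
  have "0 < (\<Sum>x\<in>X. \<beta> x * (poly (P x) y)\<^sup>2)"
    using \<open>X \<noteq> {}\<close> \<open>y \<notin> X\<close> \<beta> fin by (intro sum_pos) (auto simp: poly_P_eq_0_iff)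
  also have "\<dots> = - poly (pderiv q * p - q * pderiv p) y"
    by (simp add: wronskian poly_sum power2_eq_square)
  finally show "poly p y * poly (pderiv q) y < 0" using assms by (simp add: mult.commute)
qed

section \<open>The degree of q\<close>

lemma coeff_q_card: "Polynomial.coeff q (card X) = \<delta> * C"
  using degree_P_less by (simp add: q_def coeff_sum coeff_p_card coeff_eq_0)

lemma degree_q_le: "Polynomial.degree q \<le> card X"
  unfolding q_def
proof (intro degree_add_le degree_sum_le fin)
  show "Polynomial.degree (smult \<delta> p) \<le> card X" by (metis degree_p degree_smult_le)
  show "Polynomial.degree (smult (\<beta> x) (P x)) \<le> card X" if "x \<in> X" for x
    using degree_P_less[OF that] degree_smult_le[of "\<beta> x" "P x"] by simp
qed

text \<open>If \<open>\<delta> = 0\<close>, the coefficient one place below the top is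
  \<open>C\<close> times the sum of the residues, hence positive; so at most one degree is
  lost.\<close>

lemma card_le_Suc_degree_q: "card X \<le> Suc (Polynomial.degree q)"
proof (cases "\<delta> = 0 \<and> X \<noteq> {}")
  case True
  then have "Polynomial.coeff q (card X - 1) = (\<Sum>x\<in>X. \<beta> x * C)"
    unfolding q_def coeff_add coeff_sum by (simp add: coeff_P del: One_nat_def)
  also have "\<dots> > 0" using True fin \<beta> C by (intro sum_pos) auto
  finally show ?thesis using le_degree[of q "card X - 1"] by simp
next
  case False
  with \<delta> C coeff_q_card have "X = {} \<or> Polynomial.coeff q (card X) \<noteq> 0" by auto
  then show ?thesis using le_degree[of q "card X"] by auto
qed

end

text \<open>\<open>interlacing p q\<close> says that \<open>q/p\<close> is a Stieltjes function: \<open>q/p = \<delta> + \<Sum> \<beta>\<^sub>x / (z - x)\<close> with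
  \<open>\<delta> \<ge> 0\<close>, with all poles \<open>x\<close> negative and simple, and with residues \<open>\<beta>\<^sub>x = q(x)/p'(x) > 0\<close>.\<close>

definition interlacing :: "real poly \<Rightarrow> real poly \<Rightarrow> bool" where
  "interlacing p q \<longleftrightarrow> 
    (\<exists>C X. finite X \<and> 0 < C \<and> (\<forall>x\<in>X. x < 0) \<and> p = smult C (\<Prod>x\<in>X. [:- x, 1:])) \<and>
    Polynomial.degree q \<le> Polynomial.degree p \<and> 0 \<le> Polynomial.coeff q (Polynomial.degree p) \<and>
    (\<forall>x. poly p x = 0 \<longrightarrow> 0 < poly q x * poly (pderiv p) x)"

text \<open>Both sides have degree at most \<open>card X\<close> and agree at the points of
  \<open>X\<close> and in the coefficient of index \<open>card X\<close>.\<close>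

lemma interlacing_partial_fractions:
  assumes "interlacing p q"
  obtains X C \<delta> \<beta> where "stieltjes_pair X C \<delta> \<beta>" "p = stieltjes_pair.p X C" "q = stieltjes_pair.q X C \<delta> \<beta>"
proof -
  obtain C X where X: "finite X" "0 < C" "\<And>x. x \<in> X \<Longrightarrow> x < 0" and p: "p = smult C (\<Prod>x\<in>X. [:- x, 1:])"
    using assms by (auto simp: interlacing_def)
  \<comment> \<open>The values 0 and 1 are placeholders: this instance supplies \<open>p\<close> and
    \<open>P\<close>, from which the true \<open>\<delta>\<close> and \<open>\<beta>\<close> are
    computed.\<close>
  interpret base: stieltjes_pair X C 0 "\<lambda>_. 1" by unfold_locales (use X in auto)
  have bp: "p = base.p" by (simp add: p base.p_def)
  have deg: "Polynomial.degree q \<le> card X" and lead: "0 \<le> Polynomial.coeff q (card X)"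
    and sgn: "\<And>x. x \<in> X \<Longrightarrow> 0 < poly q x * poly (base.P x) x"
    using assms by (auto simp: interlacing_def bp base.degree_p base.poly_p_eq_0_iff base.poly_pderiv_p_X)
  define \<delta> where "\<delta> = Polynomial.coeff q (card X) / C"
  define \<beta> where "\<beta> x = poly q x / poly (base.P x) x" for x
  interpret stieltjes_pair X C \<delta> \<beta>
    by unfold_locales (use X lead sgn in \<open>auto simp: \<delta>_def \<beta>_def zero_less_divide_iff zero_less_mult_iff\<close>)
  have "q = stieltjes_pair.q X C \<delta> \<beta>"
  proof (rule poly_eqI_degree_lead_coeff[where n = "card X" and A = X])
    show "poly q x = poly (stieltjes_pair.q X C \<delta> \<beta>) x" if "x \<in> X" for x
      using that base.poly_P_eq_0_iff[of x x] by (simp add: poly_q_X \<beta>_def)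
    show "Polynomial.coeff q (card X) = Polynomial.coeff (stieltjes_pair.q X C \<delta> \<beta>) (card X)"
      unfolding coeff_q_card using C by (simp add: \<delta>_def)
  qed (use deg degree_q_le in auto)
  with bp show ?thesis by (intro that[OF stieltjes_pair_axioms])
qed

text \<open>One step of the Routh scheme, which also expands \<open>q/p\<close> into a Stieltjes continued fraction.\<close>

lemma interlacing_step:
  assumes "interlacing p q" "q \<noteq> 0"
  obtains c p1 where "0 < c" "p = smult c q + pCons 0 p1" "interlacing q p1"
    "p1 = 0 \<or> Polynomial.degree p1 < Polynomial.degree p"
proof -
  obtain X C \<delta> \<beta> where "stieltjes_pair X C \<delta> \<beta>" and 
    p: "p = stieltjes_pair.p X C" and q: "q = stieltjes_pair.q X C \<delta> \<beta>"
    using interlacing_partial_fractions[OF assms(1)] by metis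
  interpret s: stieltjes_pair X C \<delta> \<beta> by fact
  define Y where "Y = {y. poly q y = 0}"
  have Y: "y < 0 \<and> poly p y * poly (pderiv q) y < 0" if "y \<in> Y" for y
    using s.q_root_sign[of y] that assms(2) unfolding p q Y_def by auto
  have Y_fac: "q = smult (lead_coeff q) (\<Prod>y\<in>Y. [:- y, 1:])"
    unfolding Y_def
  proof (rule real_rooted_simple_factorization[OF assms(2)])
    show "z \<in> \<real>" if "poly (map_poly complex_of_real q) z = 0" for z
      using s.q_complex_roots_real assms(2) that unfolding q by blast
    show "poly (pderiv q) y \<noteq> 0" if "poly q y = 0" for y
      using Y[of y] that by (auto simp: Y_def)
  qed
  have q0: "0 < poly q 0" and p0: "0 < poly p 0"
    using s.poly_q_pos s.poly_p_pos assms(2) unfolding p q by simp_all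
  have "0 < (\<Prod>y\<in>Y. - y)" using Y by (intro prod_pos) auto
  moreover have "poly q 0 = lead_coeff q * (\<Prod>y\<in>Y. - y)"
    by (subst Y_fac) (simp add: poly_prod)
  ultimately have lead: "0 < lead_coeff q" using q0 by (simp add: zero_less_mult_iff)
  \<comment> \<open>This value makes the constant term of \<open>p - c q\<close> vanish, so that
    \<open>z\<close> can be split off.\<close>
  define c where "c = poly p 0 / poly q 0"
  have c: "0 < c" using p0 q0 by (simp add: c_def)
  obtain a p1 where ap1: "p - smult c q = pCons a p1" by (cases "p - smult c q")
  have "a = poly (pCons a p1) 0" by simp
  also have "\<dots> = 0" using q0 by (simp add: c_def flip: ap1)
  finally have p1: "p - smult c q = pCons 0 p1" using ap1 by simp
  have coeff_p1: "Polynomial.coeff p1 j = Polynomial.coeff p (Suc j) - c * Polynomial.coeff q (Suc j)" for j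
    using arg_cong[OF p1, of "\<lambda>f. Polynomial.coeff f (Suc j)"] by simp
  let ?n = "Polynomial.degree p" and ?k = "Polynomial.degree q"
  have n: "?n = card X" by (simp add: p s.degree_p)
  have k: "?k \<le> ?n" "?n \<le> Suc ?k" using s.degree_q_le s.card_le_Suc_degree_q by (simp_all add: n q)
  have "Polynomial.degree p1 \<le> ?k"
  proof (rule degree_le, intro allI impI)
    fix j assume "?k < j"
    then show "Polynomial.coeff p1 j = 0" using k by (simp add: coeff_p1 coeff_eq_0)
  qed
  moreover have "0 \<le> Polynomial.coeff p1 ?k"
  proof (cases "?n = Suc ?k")
    case True
    then have "Polynomial.coeff p (Suc ?k) = C" by (metis n p s.coeff_p_card)
    then show ?thesis using s.C by (simp add: coeff_p1 coeff_eq_0)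
  next
    case False
    then show ?thesis using k by (simp add: coeff_p1 coeff_eq_0)
  qed
  \<comment> \<open>At a zero \<open>y\<close> of \<open>q\<close> one has
    \<open>y * p1(y) = p(y)\<close>, and \<open>y < 0\<close> reverses the sign of
    \<open>p(y) * q'(y) < 0\<close>.\<close>
  moreover have "0 < poly p1 y * poly (pderiv q) y" if "y \<in> Y" for y
  proof -
    have "y * poly p1 y = poly p y"
      using arg_cong[OF p1, of "\<lambda>f. poly f y"] that by (simp add: Y_def)
    with Y[OF that] have "y * (poly p1 y * poly (pderiv q) y) < 0" by (simp flip: mult.assoc)
    with Y[OF that] show ?thesis by (auto simp: mult_less_0_iff)
  qed
  moreover have "finite Y" using assms(2) by (simp add: Y_def poly_roots_finite)
  ultimately have "interlacing q p1"
    unfolding interlacing_def using Y_fac lead Y by (auto simp: Y_def)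
  moreover have "p1 = 0 \<or> Polynomial.degree p1 < ?n"
  proof (cases "p1 = 0")
    case False
    then have "Suc (Polynomial.degree p1) = Polynomial.degree (p - smult c q)" by (simp add: p1)
    also have "\<dots> \<le> ?n" using k degree_smult_le[of c q] by (intro degree_diff_le) auto
    finally show ?thesis by simp
  qed simp
  moreover have "p = smult c q + pCons 0 p1" using p1 by (simp add: algebra_simps flip: p1)
  ultimately show ?thesis using c that by blast
qed

text \<open>Induction along the Routh scheme. The measure drops because \<open>q\<close> takes the
  place of \<open>p\<close> while \<open>p1\<close> is zero or of smaller degree than
  \<open>p\<close>.\<close>

lemma interlacing_imp_TN_hurwitz:
  assumes "interlacing p q" shows "TN (hurwitz p q)"
  using assms
proof (induction "Polynomial.degree p + (if q = 0 then 0 else Suc (Polynomial.degree q))" 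
    arbitrary: p q rule: less_induct)
  case less
  show ?case
  proof (cases "q = 0")
    case True
    obtain X C \<delta> \<beta> where "stieltjes_pair X C \<delta> \<beta>" and 
      p: "p = stieltjes_pair.p X C" and q: "q = stieltjes_pair.q X C \<delta> \<beta>"
      using interlacing_partial_fractions[OF less.prems] by metis
    interpret s: stieltjes_pair X C \<delta> \<beta> by fact
    \<comment> \<open>A zero of \<open>p\<close> would violate the strict sign condition when
      \<open>q = 0\<close>, so \<open>p\<close> is constant.\<close>
    have "X = {}"
    proof (rule ccontr)
      assume "X \<noteq> {}"
      then obtain x where "x \<in> X" by auto
      then have "poly p x = 0" by (simp add: p s.poly_p_eq_0_iff)
      with less.prems True show False by (auto simp: interlacing_def)
    qed
    then have "p = [:C:]" unfolding p s.p_def by simp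
    then show ?thesis using TN_hurwitz_const[of C] s.C True by simp
  next
    case False
    obtain c p1 where c: "0 < c" "p = smult c q + pCons 0 p1" "interlacing q p1"
      "p1 = 0 \<or> Polynomial.degree p1 < Polynomial.degree p"
      using interlacing_step[OF less.prems False] by metis
    have "TN (hurwitz q p1)"
      by (rule less.hyps[OF _ c(3)]) (use c(4) False in auto)
    then show ?thesis using c by (intro TN_hurwitz_step[of q p1 c]) auto
  qed
qed

text \<open>The logarithmic derivative \<open>g' / g\<close> is the sum of
  \<open>e x / (z - x)\<close>: a Stieltjes function with \<open>\<delta> = 0\<close> whose residues
  are the multiplicities.\<close>

lemma negative_roots_imp_TN_hurwitz:
  fixes g :: "real poly"
  assumes lead: "0 < lead_coeff g"
    and roots: "\<And>z. poly (map_poly complex_of_real g) z = 0 \<Longrightarrow> z \<in> \<real> \<and> Re z < 0"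
  shows "TN (hurwitz g (pderiv g))"
proof -
  define X where "X = {x. poly g x = 0}"
  have "g \<noteq> 0" using lead by auto
  have "\<And>z. poly (map_poly complex_of_real g) z = 0 \<Longrightarrow> z \<in> \<real>" using roots by blast
  then obtain e where g: "g = smult (lead_coeff g) (\<Prod>x\<in>X. [:- x, 1:] ^ e x)"
    and e: "\<And>x. x \<in> X \<Longrightarrow> 0 < e x"
    using real_rooted_factorization[OF \<open>g \<noteq> 0\<close>] unfolding X_def mem_Collect_eq by metis
  have fin: "finite X" unfolding X_def using \<open>g \<noteq> 0\<close> by (rule poly_roots_finite)
  have neg: "x < 0" if "x \<in> X" for x
    using roots[of "of_real x"] that by (simp add: X_def poly_map_poly_of_real)
  interpret stieltjes_pair X 1 0 "\<lambda>x. real (e x)"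
    by unfold_locales (use fin neg e in auto)
  \<comment> \<open>The common factor of \<open>g\<close> and \<open>g'\<close>, which keeps every
    root with its multiplicity lowered by one.\<close>
  define d where "d = (\<Prod>x\<in>X. [:- x, 1::real:] ^ (e x - 1))"
  have pow: "[:- x, 1::real:] ^ e x = [:- x, 1:] * [:- x, 1:] ^ (e x - 1)" if "x \<in> X" for x
    using e[OF that] by (cases "e x") auto
  have gp: "(\<Prod>x\<in>X. [:- x, 1:] ^ e x) = d * p"
    unfolding d_def p_def smult_1_left prod.distrib[symmetric]
    by (intro prod.cong refl) (simp only: pow mult.commute)
  have "pderiv (\<Prod>x\<in>X. [:- x, 1::real:] ^ e x) = (\<Sum>x\<in>X. d * smult (real (e x)) (P x))"
    unfolding pderiv_prod
  proof (intro sum.cong refl)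
    fix x assume x: "x \<in> X"
    have "(\<Prod>y\<in>X - {x}. [:- y, 1::real:] ^ e y) = (\<Prod>y\<in>X - {x}. [:- y, 1:] ^ (e y - 1)) * P x"
      unfolding P_def smult_1_left prod.distrib[symmetric]
      by (intro prod.cong refl) (simp only: pow mult.commute Diff_iff)
    moreover have "pderiv ([:- x, 1::real:] ^ e x) = smult (real (e x)) ([:- x, 1:] ^ (e x - 1))"
      using e[OF x] pderiv_power_Suc[of "[:- x, 1::real:]" "e x - 1"] by (simp add: pderiv_pCons)
    moreover have "d = [:- x, 1:] ^ (e x - 1) * (\<Prod>y\<in>X - {x}. [:- y, 1:] ^ (e y - 1))"
      unfolding d_def by (rule prod.remove[OF fin x])
    ultimately show "(\<Prod>y\<in>X - {x}. [:- y, 1::real:] ^ e y) * pderiv ([:- x, 1:] ^ e x) = d * smult (real (e x)) (P x)"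
      by (simp only: mult_smult_right mult_smult_left mult_ac)
  qed
  also have "\<dots> = d * q" by (simp add: q_def sum_distrib_left)
  finally have dq: "pderiv (\<Prod>x\<in>X. [:- x, 1:] ^ e x) = d * q" .
  have "interlacing p q"
    unfolding interlacing_def
  proof (intro conjI allI impI)
    show "\<exists>C X. finite X \<and> 0 < C \<and> (\<forall>x\<in>X. x < 0) \<and> p = smult C (\<Prod>x\<in>X. [:- x, 1:])"
      by (intro exI[of _ "1::real"] exI[of _ X] conjI ballI fin neg p_def) simp_all
    show "Polynomial.degree q \<le> Polynomial.degree p" using degree_q_le by (simp add: degree_p)
    show "0 \<le> Polynomial.coeff q (Polynomial.degree p)" using coeff_q_card by (simp add: degree_p)
    fix x assume "poly p x = 0"
    then have x: "x \<in> X" by (simp add: poly_p_eq_0_iff)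
    \<comment> \<open>The product equals \<open>e x\<close> times the square of the nonzero value of
      \<open>P x\<close> at \<open>x\<close>.\<close>
    then show "0 < poly q x * poly (pderiv p) x"
      unfolding poly_q_X[OF x] poly_pderiv_p_X[OF x] mult.assoc using e[OF x] poly_P_eq_0_iff[of x x]
      by (auto simp: zero_less_mult_iff linorder_neq_iff)
  qed
  then have "TN (hurwitz p q)" by (rule interlacing_imp_TN_hurwitz)
  then have "TN (hurwitz (d * p) (d * q))"
    unfolding d_def by (rule TN_hurwitz_mult_prod) (use neg in force)
  then have "TN (hurwitz (smult (lead_coeff g) (d * p)) (smult (lead_coeff g) (d * q)))"
    by (rule TN_hurwitz_smult) (use lead in simp)
  also have "smult (lead_coeff g) (d * q) = pderiv g"
    using arg_cong[OF g, of pderiv] by (simp only: pderiv_smult dq)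
  also have "smult (lead_coeff g) (d * p) = g" using g gp by simp
  finally show ?thesis .
qed

theorem theorem4p29:
  fixes g :: "real poly" and n :: nat
  assumes "Polynomial.degree g = n"
    and "n \<ge> 1"
    and "Polynomial.coeff g 0 \<noteq> 0"
    and "Polynomial.coeff g n > 0"
  shows "(\<forall>z::complex. poly (map_poly complex_of_real g) z = 0 \<longrightarrow> z \<in> \<real> \<and> Re z < 0)
    \<longleftrightarrow> totally_nonneg (D_inf g)"
proof
  assume "\<forall>z::complex. poly (map_poly complex_of_real g) z = 0 \<longrightarrow> z \<in> \<real> \<and> Re z < 0"
  then have "TN (hurwitz g (pderiv g))"
    using assms by (intro negative_roots_imp_TN_hurwitz) auto
  then show "totally_nonneg (D_inf g)"
    by (simp add: totally_nonneg_iff_TN D_inf_eq_hurwitz)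
next
  assume "totally_nonneg (D_inf g)"
  then have "TN (toeplitz g)" by (rule TN_toeplitz_of_D_inf)
  with assms show "\<forall>z::complex. poly (map_poly complex_of_real g) z = 0 \<longrightarrow> z \<in> \<real> \<and> Re z < 0"
    using TN_toeplitz_imp_negative_roots by blast
qed

end
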